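(* Let $0<T\le+\infty$, $\rho\in(-1,1)$, $q_r\in\mathbb{R}$, and let $\sigma,\kappa,\theta\in(0,\infty)$ satisfy $\kappa\ge\sigma\rho$ and the Feller condition $\tfrac12\sigma^2-\kappa\theta<0$. Let $r_0\in[0,\infty)$ satisfy $r_0+q_r\ge0$. Let $\gamma_0\in[1,\infty)$ be arbitrary and assume that $\beta_0,\mu_0\in(0,\infty)$ satisfy $1\le\beta_0<2\kappa\theta/\sigma^2$ and $\beta_0-1<\mu_0<\infty$. With $\mathbb{H}$, $\mathcal{A}$, $\theta_\sigma$, $\mathfrak{h}_0$ as in the context, let $u\colon\mathbb{H}\times[0,T)\to\mathbb{R}$, $u\in C^0(\mathbb{H}\times[0,T))\cap C^{2,1}(\mathbb{H}\times(0,T))$, be a strong solution of $\frac{\partial u}{\partial t}+\mathcal{A}u=0$ in $\mathbb{H}\times(0,T)$ such that $|u(x,\xi,t)|\le C\,\mathfrak{h}_0(x,\xi)$ for $(x,\xi,t)\in\mathbb{H}\times[0,T)$ with some constant $C\in(0,\infty)$, and $$|u(x,\xi,0)|\le U(x,\xi,0):=K_1\,\mathrm{e}^{x+\varpi\xi}+K_0\quad\text{for all }(x,\xi)\in\mathbb{H}.$$ Here $K_0,K_1\in[0,\infty)$ are arbitrary constants and $\varpi\in\mathbb{R}$ is a constant with $$0\le\varpi<\mu_0\quad\text{and}\quad\varpi\le\min\Bigl\{\frac{r_0+q_r}{\kappa\theta_\sigma},\ \frac{2(\kappa-\sigma\rho)}{\sigma}\Bigr\}.$$ Then $|u(x,\xi,t)|\le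 U(x,\xi,t):=\mathrm{e}^{r_0t}\,U(x,\xi,0)$ for all $(x,\xi,t)\in\mathbb{H}\times[0,T)$.
   Context: $\mathbb{H}=\mathbb{R}\times(0,\infty)$ with points $(x,\xi)$. With $\theta_\sigma=\theta/\sigma$, the Heston operator is the differential expression $$(\mathcal{A}u)(x,\xi)=-\tfrac12\sigma\xi\bigl(u_{xx}+2\rho u_{x\xi}+u_{\xi\xi}\bigr)+\bigl(q_r+\tfrac12\sigma\xi\bigr)u_x-\kappa(\theta_\sigma-\xi)u_\xi .$$ The majorizing function $\mathfrak{h}_0\colon\mathbb{H}\to(0,\infty)$ is $$\mathfrak{h}_0(x,\xi)=\xi^{-(\beta_0-1)}\exp\bigl[\gamma_0(1+x^2)^{1/2}+\mu_0\xi\bigr].$$ $C^0(\mathbb{H}\times[0,T))$ is the space of continuous functions $u\colon\mathbb{H}\times[0,T)\to\mathbb{R}$; $C^{2,1}(\mathbb{H}\times(0,T))$ is the space of continuous $u\colon\mathbb{H}\times(0,T)\to\mathbb{R}$ with $u,u_t,u_x,u_\xi,u_{xx},u_{x\xi},u_{\xi\xi}$ all existing and continuous on $\mathbb{H}\times(0,T)$. A strong solution satisfies the equation pointwise. *)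

theory Defs
  imports "HOL-Analysis.Analysis"
begin

definition half_plane :: "(real \<times> real) set"  (\<open>\<H>\<close>)
  where "\<H> = UNIV \<times> {0<..}"

text \<open>The end time is extended real, so that \<open>T = \<infinity>\<close> is allowed: these are
  \<open>[0,T)\<close> and \<open>(0,T)\<close>.\<close>

definition times_from_0 :: "ereal \<Rightarrow> real set"
  where "times_from_0 T = {t. 0 \<le> t \<and> ereal t < T}"

definition times_after_0 :: "ereal \<Rightarrow> real set"
  where "times_after_0 T = {t. 0 < t \<and> ereal t < T}"

text \<open>The value of a partial derivative carries no information where the derivative does
  not exist; existence is always asserted separately, in \<open>C21\<close> below.\<close>

definition Dx :: "(real \<Rightarrow> real \<Rightarrow> real) \<Rightarrow> real \<Rightarrow> real \<Rightarrow> real"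
  where "Dx v x \<xi> = deriv (\<lambda>y. v y \<xi>) x"

definition Dxi :: "(real \<Rightarrow> real \<Rightarrow> real) \<Rightarrow> real \<Rightarrow> real \<Rightarrow> real"
  where "Dxi v x \<xi> = deriv (\<lambda>\<eta>. v x \<eta>) \<xi>"

definition Dt :: "(real \<Rightarrow> real \<Rightarrow> real \<Rightarrow> real) \<Rightarrow> real \<Rightarrow> real \<Rightarrow> real \<Rightarrow> real"
  where "Dt u x \<xi> t = deriv (\<lambda>s. u x \<xi> s) t"

text \<open>A function on \<open>\<H> \<times> [0,T)\<close> or \<open>\<H> \<times> (0,T)\<close> is represented by a total curried
  function; its values outside the domain are irrelevant.\<close>

definition cont_on :: "((real \<times> real) \<times> real) set \<Rightarrow> (real \<Rightarrow> real \<Rightarrow> real \<Rightarrow> real) \<Rightarrow> bool"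
  where "cont_on Q u \<longleftrightarrow> continuous_on Q (\<lambda>((x, \<xi>), t). u x \<xi> t)"

definition C0 :: "ereal \<Rightarrow> (real \<Rightarrow> real \<Rightarrow> real \<Rightarrow> real) \<Rightarrow> bool"
  where "C0 T u \<longleftrightarrow> cont_on (\<H> \<times> times_from_0 T) u"

text \<open>The mixed derivative \<open>u\<^sub>x\<^sub>\<xi>\<close> is read as \<open>(u\<^sub>x)\<^sub>\<xi>\<close>. Since it is required to be continuous,
  as are the first-order derivatives, the other order gives the same class and the same
  derivative (Schwarz--Peano).\<close>

definition C21 :: "ereal \<Rightarrow> (real \<Rightarrow> real \<Rightarrow> real \<Rightarrow> real) \<Rightarrow> bool"
  where "C21 T u \<longleftrightarrow>
    (\<forall>(x, \<xi>)\<in>\<H>. \<forall>t\<in>times_after_0 T.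
       (\<lambda>s. u x \<xi> s) field_differentiable (at t) \<and>
       (\<lambda>y. u y \<xi> t) field_differentiable (at x) \<and>
       (\<lambda>\<eta>. u x \<eta> t) field_differentiable (at \<xi>) \<and>
       (\<lambda>y. Dx (\<lambda>x \<xi>. u x \<xi> t) y \<xi>) field_differentiable (at x) \<and>
       (\<lambda>\<eta>. Dx (\<lambda>x \<xi>. u x \<xi> t) x \<eta>) field_differentiable (at \<xi>) \<and>
       (\<lambda>\<eta>. Dxi (\<lambda>x \<xi>. u x \<xi> t) x \<eta>) field_differentiable (at \<xi>)) \<and>
    (let Q = \<H> \<times> times_after_0 T in
       cont_on Q u \<and>
       cont_on Q (Dt u) \<and>
       cont_on Q (\<lambda>x \<xi> t. Dx (\<lambda>x \<xi>. u x \<xi> t) x \<xi>) \<and>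
       cont_on Q (\<lambda>x \<xi> t. Dxi (\<lambda>x \<xi>. u x \<xi> t) x \<xi>) \<and>
       cont_on Q (\<lambda>x \<xi> t. Dx (Dx (\<lambda>x \<xi>. u x \<xi> t)) x \<xi>) \<and>
       cont_on Q (\<lambda>x \<xi> t. Dxi (Dx (\<lambda>x \<xi>. u x \<xi> t)) x \<xi>) \<and>
       cont_on Q (\<lambda>x \<xi> t. Dxi (Dxi (\<lambda>x \<xi>. u x \<xi> t)) x \<xi>))"

definition heston_op ::
    "real \<Rightarrow> real \<Rightarrow> real \<Rightarrow> real \<Rightarrow> real \<Rightarrow> (real \<Rightarrow> real \<Rightarrow> real) \<Rightarrow> real \<Rightarrow> real \<Rightarrow> real"
  where "heston_op \<sigma> \<rho> q\<^sub>r \<kappa> \<theta> v x \<xi> =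
    - (1/2) * \<sigma> * \<xi> * (Dx (Dx v) x \<xi> + 2 * \<rho> * Dxi (Dx v) x \<xi> + Dxi (Dxi v) x \<xi>)
    + (q\<^sub>r + (1/2) * \<sigma> * \<xi>) * Dx v x \<xi>
    - \<kappa> * (\<theta> / \<sigma> - \<xi>) * Dxi v x \<xi>"

definition heston_strong_solution ::
    "real \<Rightarrow> real \<Rightarrow> real \<Rightarrow> real \<Rightarrow> real \<Rightarrow> ereal \<Rightarrow> (real \<Rightarrow> real \<Rightarrow> real \<Rightarrow> real) \<Rightarrow> bool"
  where "heston_strong_solution \<sigma> \<rho> q\<^sub>r \<kappa> \<theta> T u \<longleftrightarrow>
    C0 T u \<and> C21 T u \<and>
    (\<forall>(x, \<xi>)\<in>\<H>. \<forall>t\<in>times_after_0 T.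
       Dt u x \<xi> t + heston_op \<sigma> \<rho> q\<^sub>r \<kappa> \<theta> (\<lambda>x \<xi>. u x \<xi> t) x \<xi> = 0)"

definition majorizer :: "real \<Rightarrow> real \<Rightarrow> real \<Rightarrow> real \<Rightarrow> real \<Rightarrow> real"
  where "majorizer \<beta>\<^sub>0 \<gamma>\<^sub>0 \<mu>\<^sub>0 x \<xi> =
    \<xi> powr (- (\<beta>\<^sub>0 - 1)) * exp (\<gamma>\<^sub>0 * sqrt (1 + x\<^sup>2) + \<mu>\<^sub>0 * \<xi>)"

end

theory Submission
  imports Defs
begin

text \<open>The function \<open>U\<close> is a supersolution precisely because of the two upper bounds on \<open>\<omega>\<close>, so
  \<open>w = \<plusminus>u - U\<close> is a subsolution that is nonpositive initially and at most \<open>C h\<^sub>0\<close>. It is compared with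
  \<open>\<epsilon> H\<close>, where \<open>H = y powr (-b) * exp (\<gamma> sqrt (1 + x\<^sup>2) + (m + M (t - a)) y + \<nu> (t - a))\<close> has
  slightly larger exponents than \<open>h\<^sub>0\<close> and therefore dominates it near the boundary of the half-plane and
  at infinity. The growth in time of the coefficient of \<open>y\<close> makes \<open>H\<close> a strict supersolution as long
  as this coefficient stays bounded, that is for \<open>t - a \<le> 1/M\<close>; a maximum principle and \<open>\<epsilon> \<rightarrow> 0\<close> give
  \<open>w \<le> 0\<close> on this time interval, whose length does not depend on \<open>a\<close>, so the argument can be iterated.\<close>

section \<open>Second-order conditions at an interior maximum\<close>

text \<open>The Lagrange remainder with an intermediate point that is only confined to distance
  \<open>d\<close> of \<open>c\<close>. This covers both sides of \<open>c\<close> and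
  \<open>x = c\<close> uniformly, and it is all that a continuity argument for \<open>g''\<close>
  requires.\<close>

lemma taylor_second_order:
  fixes g g' g'' :: "real \<Rightarrow> real"
  assumes g: "\<And>z. \<bar>z - c\<bar> \<le> d \<Longrightarrow> (g has_real_derivative g' z) (at z)"
    and g': "\<And>z. \<bar>z - c\<bar> \<le> d \<Longrightarrow> (g' has_real_derivative g'' z) (at z)"
    and x: "\<bar>x - c\<bar> \<le> d"
  shows "\<exists>z. \<bar>z - c\<bar> \<le> d \<and> g x = g c + g' c * (x - c) + g'' z / 2 * (x - c)\<^sup>2"
proof (cases "x = c")
  case True
  with x show ?thesis by (intro exI[of _ c]) auto
next
  case False
  define D where "D m = (if m = 0 then g else if m = 1 then g' else g'')" for m :: nat
  have "\<exists>z. (if x < c then x < z \<and> z < c else c < z \<and> z < x) \<and>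
      g x = (\<Sum>m<2. D m c / fact m * (x - c) ^ m) + D 2 z / fact 2 * (x - c) ^ 2"
  proof (rule Taylor[where a = "c - d" and b = "c + d"])
    show "\<forall>m t. m < 2 \<and> c - d \<le> t \<and> t \<le> c + d \<longrightarrow> DERIV (D m) t :> D (Suc m) t"
    proof (intro allI impI)
      fix m :: nat and t
      assume *: "m < 2 \<and> c - d \<le> t \<and> t \<le> c + d"
      then have "m = 0 \<or> m = 1" and t: "\<bar>t - c\<bar> \<le> d" by auto
      then show "DERIV (D m) t :> D (Suc m) t"
        using g[OF t] g'[OF t] by (auto simp: D_def)
    qed
  qed (use x False in \<open>auto simp: D_def\<close>)
  then obtain z where z: "if x < c then x < z \<and> z < c else c < z \<and> z < x"
    and eq: "g x = (\<Sum>m<2. D m c / fact m * (x - c) ^ m) + D 2 z / fact 2 * (x - c) ^ 2"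
    by blast
  have "\<bar>z - c\<bar> \<le> d" using z x by (auto split: if_splits)
  moreover have "g x = g c + g' c * (x - c) + g'' z / 2 * (x - c)\<^sup>2"
    using eq by (simp add: D_def numeral_2_eq_2)
  ultimately show ?thesis by blast
qed

text \<open>Closed squares rather than balls, because the intermediate points of the expansions
  below are located one coordinate at a time.\<close>

lemma continuous_on_open_pair_square:
  fixes F :: "real \<times> real \<Rightarrow> real"
  assumes "open S" and "continuous_on S F" and "(x0, y0) \<in> S" and "0 < e"
  shows "\<exists>d>0. \<forall>x y. \<bar>x - x0\<bar> \<le> d \<longrightarrow> \<bar>y - y0\<bar> \<le> d \<longrightarrow> (x, y) \<in> S \<and> \<bar>F (x, y) - F (x0, y0)\<bar> < e"
proof -
  obtain r where r: "0 < r" "ball (x0, y0) r \<subseteq> S"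
    using assms openE by blast
  obtain r' where r': "0 < r'" "\<And>p. p \<in> S \<Longrightarrow> dist p (x0, y0) < r' \<Longrightarrow> dist (F p) (F (x0, y0)) < e"
    using assms(2-4) unfolding continuous_on_iff by blast
  \<comment> \<open>Within the square the distance to the centre is at most \<open>2 * d\<close>, so
    a third of the smaller radius stays strictly inside both balls.\<close>
  define d where "d = min r r' / 3"
  have d: "0 < d" "2 * d < r" "2 * d < r'" using r r' by (auto simp: d_def)
  have "(x, y) \<in> S \<and> \<bar>F (x, y) - F (x0, y0)\<bar> < e" if "\<bar>x - x0\<bar> \<le> d" "\<bar>y - y0\<bar> \<le> d" for x y
  proof -
    have "dist (x, y) (x0, y0) \<le> \<bar>x - x0\<bar> + \<bar>y - y0\<bar>"
      using sqrt_sum_squares_le_sum_abs[of "x - x0" "y - y0"] by (simp add: dist_Pair_Pair dist_real_def)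
    with that d have "dist (x, y) (x0, y0) < r" "dist (x, y) (x0, y0) < r'" by linarith+
    then show ?thesis using r r'(2)[of "(x, y)"] by (auto simp: dist_real_def dist_commute subset_iff)
  qed
  then show ?thesis using d by blast
qed

text \<open>Expanding first in \<open>x\<close> and then in \<open>y\<close> uses only \<open>(f\<^sub>x)\<^sub>y\<close>, which makes the symmetry of
  second derivatives unnecessary. The case of general \<open>\<rho>\<close> is a convex combination of \<open>\<rho> = \<plusminus>1\<close>.\<close>

lemma mixed_second_derivative_at_max:
  fixes f fx fy fxx fxy fyy :: "real \<Rightarrow> real \<Rightarrow> real"
  assumes S: "open S" "(x0, y0) \<in> S"
    and dx: "\<And>x y. (x, y) \<in> S \<Longrightarrow> ((\<lambda>x. f x y) has_real_derivative fx x y) (at x)"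
    and dy: "\<And>x y. (x, y) \<in> S \<Longrightarrow> ((\<lambda>y. f x y) has_real_derivative fy x y) (at y)"
    and dxx: "\<And>x y. (x, y) \<in> S \<Longrightarrow> ((\<lambda>x. fx x y) has_real_derivative fxx x y) (at x)"
    and dxy: "\<And>x y. (x, y) \<in> S \<Longrightarrow> ((\<lambda>y. fx x y) has_real_derivative fxy x y) (at y)"
    and dyy: "\<And>x y. (x, y) \<in> S \<Longrightarrow> ((\<lambda>y. fy x y) has_real_derivative fyy x y) (at y)"
    and cxx: "continuous_on S (\<lambda>(x, y). fxx x y)"
    and cxy: "continuous_on S (\<lambda>(x, y). fxy x y)"
    and cyy: "continuous_on S (\<lambda>(x, y). fyy x y)"
    and max: "\<And>x y. (x, y) \<in> S \<Longrightarrow> f x y \<le> f x0 y0"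
  shows "fx x0 y0 = 0" and "fy x0 y0 = 0"
    and "\<bar>\<rho>\<bar> \<le> 1 \<Longrightarrow> fxx x0 y0 + 2 * \<rho> * fxy x0 y0 + fyy x0 y0 \<le> 0"
proof -
  obtain d0 where d0: "d0 > 0" "\<And>x y. \<bar>x - x0\<bar> \<le> d0 \<Longrightarrow> \<bar>y - y0\<bar> \<le> d0 \<Longrightarrow> (x, y) \<in> S"
    using continuous_on_open_pair_square[OF S(1) cxx S(2), of 1] by auto
  show fx0: "fx x0 y0 = 0"
    by (rule DERIV_local_max[OF dx[OF S(2)] d0(1)]) (use d0 max in auto)
  show fy0: "fy x0 y0 = 0"
    by (rule DERIV_local_max[OF dy[OF S(2)] d0(1)]) (use d0 max in auto)
  \<comment> \<open>This is the second derivative in the diagonal direction (1, c). Were it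
    positive, f would exceed its maximum at the point \<open>(x0 + d, y0 + c * d)\<close>.\<close>
  have diag: "fxx x0 y0 + 2 * c * fxy x0 y0 + fyy x0 y0 \<le> 0" if c: "c = 1 \<or> c = -1" for c
  proof (rule ccontr)
    define s where "s = fxx x0 y0 + 2 * c * fxy x0 y0 + fyy x0 y0"
    assume "\<not> ?thesis"
    \<comment> \<open>The two pure derivatives enter once and the mixed one twice, so errors below
      \<open>s / 8\<close> each add up to less than \<open>s / 2\<close>.\<close>
    then have s: "0 < s / 8" by (simp add: s_def)
    obtain d1 where d1: "d1 > 0" "\<And>x y. \<bar>x - x0\<bar> \<le> d1 \<Longrightarrow> \<bar>y - y0\<bar> \<le> d1 \<Longrightarrow> \<bar>fxx x y - fxx x0 y0\<bar> < s/8"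
      using continuous_on_open_pair_square[OF S(1) cxx S(2) s] by auto
    obtain d2 where d2: "d2 > 0" "\<And>x y. \<bar>x - x0\<bar> \<le> d2 \<Longrightarrow> \<bar>y - y0\<bar> \<le> d2 \<Longrightarrow> \<bar>fxy x y - fxy x0 y0\<bar> < s/8"
      using continuous_on_open_pair_square[OF S(1) cxy S(2) s] by auto
    obtain d3 where d3: "d3 > 0" "\<And>x y. \<bar>x - x0\<bar> \<le> d3 \<Longrightarrow> \<bar>y - y0\<bar> \<le> d3 \<Longrightarrow> \<bar>fyy x y - fyy x0 y0\<bar> < s/8"
      using continuous_on_open_pair_square[OF S(1) cyy S(2) s] by auto
    define d where "d = Min {d0, d1, d2, d3}"
    have d: "0 < d" "d \<le> d0" "d \<le> d1" "d \<le> d2" "d \<le> d3" using d0 d1 d2 d3 by (auto simp: d_def)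
    have inS: "(x, y) \<in> S" if "\<bar>x - x0\<bar> \<le> d" "\<bar>y - y0\<bar> \<le> d" for x y
      using that d d0(2) by auto
    define y where "y = y0 + c * d"
    have y: "\<bar>y - y0\<bar> \<le> d" using c d by (auto simp: y_def)
    have "\<exists>z. \<bar>z - x0\<bar> \<le> d \<and>
        f (x0 + d) y = f x0 y + fx x0 y * (x0 + d - x0) + fxx z y / 2 * (x0 + d - x0)\<^sup>2"
      by (rule taylor_second_order) (use d y in \<open>auto intro!: dx dxx inS\<close>)
    then obtain z1 where z1: "\<bar>z1 - x0\<bar> \<le> d" "f (x0 + d) y = f x0 y + fx x0 y * d + fxx z1 y / 2 * d\<^sup>2"
      by auto
    have "\<exists>z. \<bar>z - y0\<bar> \<le> d \<and>
        f x0 y = f x0 y0 + fy x0 y0 * (y - y0) + fyy x0 z / 2 * (y - y0)\<^sup>2"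
      by (rule taylor_second_order) (use d y in \<open>auto intro!: dy dyy inS\<close>)
    then obtain z2 where z2: "\<bar>z2 - y0\<bar> \<le> d" "f x0 y = f x0 y0 + fyy x0 z2 / 2 * d\<^sup>2"
      using fy0 c by (auto simp: y_def)
    have "\<exists>z. \<bar>z - y0\<bar> \<le> d \<and> fx x0 y = fx x0 y0 + fxy x0 z * (y - y0)"
    proof -
      have ex: "\<exists>z. a < z \<and> z < b \<and> fx x0 b - fx x0 a = (b - a) * fxy x0 z"
        if "a < b" "\<bar>a - y0\<bar> \<le> d" "\<bar>b - y0\<bar> \<le> d" for a b
        by (rule MVT2) (use that d in \<open>auto intro!: dxy inS\<close>)
      \<comment> \<open>\<open>MVT2\<close> wants ordered endpoints, and the order depends on the
        sign of \<open>c\<close>.\<close>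
      consider "y0 < y" | "y < y0" using c d by (auto simp: y_def)
      then show ?thesis
      proof cases
        case 1
        with ex[OF 1] y d obtain z where "y0 < z" "z < y" "fx x0 y - fx x0 y0 = (y - y0) * fxy x0 z" by auto
        with y show ?thesis by (intro exI[of _ z]) (auto simp: algebra_simps)
      next
        case 2
        with ex[OF 2] y d obtain z where "y < z" "z < y0" "fx x0 y0 - fx x0 y = (y0 - y) * fxy x0 z" by auto
        with y show ?thesis by (intro exI[of _ z]) (auto simp: algebra_simps)
      qed
    qed
    then obtain z3 where z3: "\<bar>z3 - y0\<bar> \<le> d" "fx x0 y = c * d * fxy x0 z3"
      using fx0 by (auto simp: y_def)
    have "f (x0 + d) y \<le> f x0 y0" using d y by (intro max inS) auto
    \<comment> \<open>Since \<open>fx\<close> and \<open>fy\<close> vanish at the maximum and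
      \<open>c\<close> squares to 1, the increment of f from the maximum to
      \<open>(x0 + d, y)\<close> is half of the left-hand side.\<close>
    then have "d\<^sup>2 * (fxx z1 y + 2 * c * fxy x0 z3 + fyy x0 z2) \<le> 0"
      using z1 z2 z3 by (simp add: algebra_simps power2_eq_square)
    then have le: "fxx z1 y + 2 * c * fxy x0 z3 + fyy x0 z2 \<le> 0"
      using d(1) by (simp add: mult_le_0_iff)
    have "\<bar>fxx z1 y - fxx x0 y0\<bar> < s/8" by (rule d1(2)) (use d y z1 in linarith)+
    moreover have "\<bar>fxy x0 z3 - fxy x0 y0\<bar> < s/8" by (rule d2(2)) (use d z3 in simp_all)
    moreover have "\<bar>fyy x0 z2 - fyy x0 y0\<bar> < s/8" by (rule d3(2)) (use d z2 in simp_all)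
    moreover have "s = fxx x0 y0 + 2 * fxy x0 y0 + fyy x0 y0 \<and> fxx z1 y + 2 * fxy x0 z3 + fyy x0 z2 \<le> 0 \<or>
        s = fxx x0 y0 - 2 * fxy x0 y0 + fyy x0 y0 \<and> fxx z1 y - 2 * fxy x0 z3 + fyy x0 z2 \<le> 0"
      using c le by (auto simp: s_def)
    ultimately show False using s by linarith
  qed
  assume "\<bar>\<rho>\<bar> \<le> 1"
  then have "(1 + \<rho>) / 2 * (fxx x0 y0 + 2 * 1 * fxy x0 y0 + fyy x0 y0)
      + (1 - \<rho>) / 2 * (fxx x0 y0 + 2 * (-1) * fxy x0 y0 + fyy x0 y0) \<le> 0 + 0"
    by (intro add_mono mult_nonneg_nonpos diag) auto
  then show "fxx x0 y0 + 2 * \<rho> * fxy x0 y0 + fyy x0 y0 \<le> 0"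
    by (simp add: field_simps)
qed

section \<open>The maximum principle on the half-plane\<close>

text \<open>Partial derivatives are carried along as explicit functions, so that sums and
  differences need no reasoning about \<^const>\<open>deriv\<close>.\<close>

definition C21_jet ::
    "real set \<Rightarrow> (real \<Rightarrow> real \<Rightarrow> real \<Rightarrow> real) \<Rightarrow> (real \<Rightarrow> real \<Rightarrow> real \<Rightarrow> real) \<Rightarrow>
     (real \<Rightarrow> real \<Rightarrow> real \<Rightarrow> real) \<Rightarrow> (real \<Rightarrow> real \<Rightarrow> real \<Rightarrow> real) \<Rightarrow>
     (real \<Rightarrow> real \<Rightarrow> real \<Rightarrow> real) \<Rightarrow> (real \<Rightarrow> real \<Rightarrow> real \<Rightarrow> real) \<Rightarrow>
     (real \<Rightarrow> real \<Rightarrow> real \<Rightarrow> real) \<Rightarrow> bool"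
  where "C21_jet I v vt vx vy vxx vxy vyy \<longleftrightarrow>
    (\<forall>t\<in>I.
      (\<forall>x. \<forall>y>0.
        ((\<lambda>t. v x y t) has_real_derivative vt x y t) (at t) \<and>
        ((\<lambda>x. v x y t) has_real_derivative vx x y t) (at x) \<and>
        ((\<lambda>y. v x y t) has_real_derivative vy x y t) (at y) \<and>
        ((\<lambda>x. vx x y t) has_real_derivative vxx x y t) (at x) \<and>
        ((\<lambda>y. vx x y t) has_real_derivative vxy x y t) (at y) \<and>
        ((\<lambda>y. vy x y t) has_real_derivative vyy x y t) (at y)) \<and>
      continuous_on \<H> (\<lambda>(x, y). vxx x y t) \<and>
      continuous_on \<H> (\<lambda>(x, y). vxy x y t) \<and>
      continuous_on \<H> (\<lambda>(x, y). vyy x y t))"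

text \<open>The Heston operator with the derivatives replaced by independent numbers: its linearity
  becomes pure algebra, and it can be evaluated on any jet.\<close>

definition heston_form ::
    "real \<Rightarrow> real \<Rightarrow> real \<Rightarrow> real \<Rightarrow> real \<Rightarrow> real \<Rightarrow> real \<Rightarrow> real \<Rightarrow> real \<Rightarrow> real \<Rightarrow> real \<Rightarrow> real"
  where "heston_form \<sigma> \<rho> q \<kappa> \<theta> y vx vy vxx vxy vyy =
    - (1/2) * \<sigma> * y * (vxx + 2 * \<rho> * vxy + vyy)
    + (q + (1/2) * \<sigma> * y) * vx - \<kappa> * (\<theta> / \<sigma> - y) * vy"

lemma C21_jet_mono:
  "C21_jet I v vt vx vy vxx vxy vyy \<Longrightarrow> J \<subseteq> I \<Longrightarrow> C21_jet J v vt vx vy vxx vxy vyy"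
  unfolding C21_jet_def by blast

lemma C21_jet_lincomb:
  assumes "C21_jet I v vt vx vy vxx vxy vyy" "C21_jet I w wt wx wy wxx wxy wyy"
  shows "C21_jet I (\<lambda>x y t. a * v x y t + b * w x y t) (\<lambda>x y t. a * vt x y t + b * wt x y t)
    (\<lambda>x y t. a * vx x y t + b * wx x y t) (\<lambda>x y t. a * vy x y t + b * wy x y t)
    (\<lambda>x y t. a * vxx x y t + b * wxx x y t) (\<lambda>x y t. a * vxy x y t + b * wxy x y t)
    (\<lambda>x y t. a * vyy x y t + b * wyy x y t)"
  using assms unfolding C21_jet_def split_def
  by (auto intro!: DERIV_add DERIV_cmult continuous_intros)

lemma open_half_plane: "open \<H>"
  unfolding half_plane_def by (intro open_Times) auto

lemma heston_form_lincomb: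
  "heston_form \<sigma> \<rho> q \<kappa> \<theta> y (a * p + b * p') (a * r + b * r') (a * l + b * l') (a * m + b * m') (a * n + b * n')
    = a * heston_form \<sigma> \<rho> q \<kappa> \<theta> y p r l m n + b * heston_form \<sigma> \<rho> q \<kappa> \<theta> y p' r' l' m' n'"
  unfolding heston_form_def by (simp add: algebra_simps)

text \<open>By \<open>outside\<close>, a positive value forces a positive maximum attained in a
  compact box at a time after \<open>a\<close>. There the time derivative is nonnegative, the
  gradient vanishes and the second-order part is nonpositive, which contradicts the strict
  inequality \<open>sub\<close>.\<close>

lemma heston_maximum_principle:
  assumes jet: "C21_jet {a<..b} v vt vx vy vxx vxy vyy"
    and cont: "cont_on (\<H> \<times> {a..b}) v"
    and sub: "\<And>x y t. 0 < y \<Longrightarrow> a < t \<Longrightarrow> t \<le> b \<Longrightarrow>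
      vt x y t + heston_form \<sigma> \<rho> q \<kappa> \<theta> y (vx x y t) (vy x y t) (vxx x y t) (vxy x y t) (vyy x y t) < 0"
    and init: "\<And>x y. 0 < y \<Longrightarrow> v x y a \<le> 0"
    and r: "0 < r"
    and outside: "\<And>x y t. 0 < y \<Longrightarrow> a \<le> t \<Longrightarrow> t \<le> b \<Longrightarrow>
      R \<le> \<bar>x\<bar> \<or> y \<le> r \<or> R \<le> y \<Longrightarrow> v x y t \<le> 0"
    and \<sigma>: "0 < \<sigma>" and \<rho>: "\<bar>\<rho>\<bar> \<le> 1"
    and y: "0 < y" and t: "a \<le> t" "t \<le> b"
  shows "v x y t \<le> 0"
proof (rule ccontr)
  assume pos: "\<not> v x y t \<le> 0"
  define K where "K = ({-R..R} \<times> {r..R}) \<times> {a..b}"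
  have "\<not> (R \<le> \<bar>x\<bar> \<or> y \<le> r \<or> R \<le> y)" using outside pos y t by blast
  then have K: "((x, y), t) \<in> K" using t by (auto simp: K_def)
  have "compact K" unfolding K_def by (intro compact_Times) auto
  moreover have "continuous_on K (\<lambda>((x, \<xi>), t). v x \<xi> t)"
    using cont unfolding cont_on_def
    by (rule continuous_on_subset) (use r in \<open>auto simp: K_def half_plane_def\<close>)
  ultimately obtain P where P: "P \<in> K"
    "\<And>Q. Q \<in> K \<Longrightarrow> (\<lambda>((x, \<xi>), t). v x \<xi> t) Q \<le> (\<lambda>((x, \<xi>), t). v x \<xi> t) P"
    using continuous_attains_sup[of K] K by blast
  obtain x0 y0 t0 where P_eq: "P = ((x0, y0), t0)" by (metis prod.exhaust)
  have maxK: "v x' y' t' \<le> v x0 y0 t0" if "((x', y'), t') \<in> K" for x' y' t'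
    using P(2)[OF that] by (simp add: P_eq)
  have P0: "r \<le> y0" "a \<le> t0" "t0 \<le> b" using P(1) by (auto simp: P_eq K_def)
  have pos0: "0 < v x0 y0 t0" using maxK[OF K] pos by simp
  have y0: "0 < y0" using P0 r by simp
  \<comment> \<open>Off \<open>K\<close> the function is nonpositive, so the maximum over
    \<open>K\<close> is global. Its spatial point is therefore an interior maximum in the open
    half-plane, wherever it lies in the box.\<close>
  have max: "v x' y' t' \<le> v x0 y0 t0" if "0 < y'" "a \<le> t'" "t' \<le> b" for x' y' t'
  proof (cases "((x', y'), t') \<in> K")
    case False
    then have "v x' y' t' \<le> 0" using that by (intro outside) (auto simp: K_def)
    then show ?thesis using pos0 by simp
  qed (rule maxK)
  have "t0 \<noteq> a" using init[OF y0, of x0] pos0 by auto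
  then have t0: "a < t0" "t0 \<le> b" using P0 by auto
  have D: "\<forall>x. \<forall>y>0.
        ((\<lambda>t. v x y t) has_real_derivative vt x y t0) (at t0) \<and>
        ((\<lambda>x. v x y t0) has_real_derivative vx x y t0) (at x) \<and>
        ((\<lambda>y. v x y t0) has_real_derivative vy x y t0) (at y) \<and>
        ((\<lambda>x. vx x y t0) has_real_derivative vxx x y t0) (at x) \<and>
        ((\<lambda>y. vx x y t0) has_real_derivative vxy x y t0) (at y) \<and>
        ((\<lambda>y. vy x y t0) has_real_derivative vyy x y t0) (at y)"
     "continuous_on \<H> (\<lambda>(x, y). vxx x y t0)"
     "continuous_on \<H> (\<lambda>(x, y). vxy x y t0)"
     "continuous_on \<H> (\<lambda>(x, y). vyy x y t0)"
    using jet t0 unfolding C21_jet_def by auto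
  \<comment> \<open>The maximum may occur at the final time \<open>b\<close>, so only earlier times
    are compared; hence an inequality and not a vanishing derivative.\<close>
  have "0 \<le> vt x0 y0 t0"
  proof (rule ccontr)
    assume "\<not> ?thesis"
    then obtain d where d: "d > 0" "\<And>h. 0 < h \<Longrightarrow> h < d \<Longrightarrow> v x0 y0 t0 < v x0 y0 (t0 - h)"
      using DERIV_neg_dec_left[of "\<lambda>t. v x0 y0 t" "vt x0 y0 t0" t0] D(1) y0 by auto
    define h where "h = min (d/2) (t0 - a)"
    have "0 < h" "h < d" "a \<le> t0 - h" using d t0 by (auto simp: h_def)
    then show False using d(2)[of h] max[of y0 "t0 - h" x0] y0 t0 by auto
  qed
  moreover have "vx x0 y0 t0 = 0" "vy x0 y0 t0 = 0"
    "vxx x0 y0 t0 + 2 * \<rho> * vxy x0 y0 t0 + vyy x0 y0 t0 \<le> 0"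
  proof -
    have S: "(x0, y0) \<in> \<H>" using y0 by (simp add: half_plane_def)
    note * = mixed_second_derivative_at_max[OF open_half_plane S, of "\<lambda>x y. v x y t0" "\<lambda>x y. vx x y t0"
      "\<lambda>x y. vy x y t0" "\<lambda>x y. vxx x y t0" "\<lambda>x y. vxy x y t0" "\<lambda>x y. vyy x y t0"]
    show "vx x0 y0 t0 = 0" by (rule *(1)) (use D max t0 in \<open>auto simp: half_plane_def\<close>)
    show "vy x0 y0 t0 = 0" by (rule *(2)) (use D max t0 in \<open>auto simp: half_plane_def\<close>)
    show "vxx x0 y0 t0 + 2 * \<rho> * vxy x0 y0 t0 + vyy x0 y0 t0 \<le> 0"
      by (rule *(3)) (use D max t0 \<rho> in \<open>auto simp: half_plane_def\<close>)
  qed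
  moreover from this(3) have "\<sigma> * y0 * (vxx x0 y0 t0 + 2 * \<rho> * vxy x0 y0 t0 + vyy x0 y0 t0) \<le> 0"
    using \<sigma> y0 by (intro mult_nonneg_nonpos) auto
  ultimately show False
    using sub[OF y0 t0, of x0] by (simp add: heston_form_def)
qed

section \<open>The barrier function\<close>

text \<open>The power of y is written as \<open>exp (- b * ln y)\<close> so that the whole function
  is one exponential, and every derivative is the function itself times an explicit factor.\<close>

definition heston_barrier ::
    "real \<Rightarrow> real \<Rightarrow> real \<Rightarrow> real \<Rightarrow> real \<Rightarrow> real \<Rightarrow> real \<Rightarrow> real \<Rightarrow> real \<Rightarrow> real"
  where "heston_barrier b \<gamma> m M \<nu> a x y t =
    exp (- b * ln y + \<gamma> * sqrt (1 + x\<^sup>2) + (m + M * (t - a)) * y + \<nu> * (t - a))"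

lemma sqrt_one_plus_square_has_derivative:
  "((\<lambda>x::real. sqrt (1 + x\<^sup>2)) has_real_derivative x / sqrt (1 + x\<^sup>2)) (at x)"
  "((\<lambda>x::real. x / sqrt (1 + x\<^sup>2)) has_real_derivative 1 / sqrt (1 + x\<^sup>2) ^ 3) (at x)"
proof -
  have pos: "0 < 1 + x\<^sup>2" by (simp add: add_pos_nonneg)
  then have s: "0 < sqrt (1 + x\<^sup>2)" by simp
  have sq: "sqrt (1 + x\<^sup>2) ^ 2 = 1 + x\<^sup>2" using pos by simp
  show *: "((\<lambda>x::real. sqrt (1 + x\<^sup>2)) has_real_derivative x / sqrt (1 + x\<^sup>2)) (at x)"
    using pos by (auto intro!: derivative_eq_intros simp: field_simps)
  have "(1 * sqrt (1 + x\<^sup>2) - x * (x / sqrt (1 + x\<^sup>2))) / (sqrt (1 + x\<^sup>2) * sqrt (1 + x\<^sup>2))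
      = (sqrt (1 + x\<^sup>2) ^ 2 - x\<^sup>2) / sqrt (1 + x\<^sup>2) ^ 3"
    using s by (simp add: field_simps power2_eq_square power3_eq_cube)
  also have "\<dots> = 1 / sqrt (1 + x\<^sup>2) ^ 3" unfolding sq by simp
  finally show "((\<lambda>x::real. x / sqrt (1 + x\<^sup>2)) has_real_derivative 1 / sqrt (1 + x\<^sup>2) ^ 3) (at x)"
    using DERIV_divide[OF DERIV_ident *] s by simp
qed

text \<open>Here \<open>p\<close> and \<open>l\<close> are the x- and y-derivatives of the exponent.
  A pure second derivative of \<open>H\<close> is \<open>H\<close> times the square of such a factor
  plus its derivative; the mixed one is just \<open>H * p * l\<close>, because \<open>p\<close> does
  not depend on y.\<close>

lemma C21_jet_barrier:
  fixes b \<gamma> m M \<nu> a :: real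
  defines "H \<equiv> heston_barrier b \<gamma> m M \<nu> a"
    and "p \<equiv> \<lambda>x. \<gamma> * (x / sqrt (1 + x\<^sup>2))"
    and "l \<equiv> \<lambda>y t. m + M * (t - a) - b / y"
  shows "C21_jet UNIV H (\<lambda>x y t. H x y t * (M * y + \<nu>))
    (\<lambda>x y t. H x y t * p x) (\<lambda>x y t. H x y t * l y t)
    (\<lambda>x y t. H x y t * ((p x)\<^sup>2 + \<gamma> * (1 / sqrt (1 + x\<^sup>2) ^ 3)))
    (\<lambda>x y t. H x y t * (p x * l y t))
    (\<lambda>x y t. H x y t * ((l y t)\<^sup>2 + b / y\<^sup>2))"
proof -
  have Ht: "((\<lambda>t. H x y t) has_real_derivative H x y t * (M * y + \<nu>)) (at t)" for x y t
    unfolding H_def heston_barrier_def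
    by (auto intro!: derivative_eq_intros simp: algebra_simps)
  have Hx: "((\<lambda>x. H x y t) has_real_derivative H x y t * p x) (at x)" for x y t
  proof -
    have "0 < 1 + x\<^sup>2" by (simp add: add_pos_nonneg)
    then show ?thesis unfolding H_def heston_barrier_def p_def
      by (auto intro!: derivative_eq_intros simp: field_simps)
  qed
  have Hy: "((\<lambda>y. H x y t) has_real_derivative H x y t * l y t) (at y)" if "0 < y" for x y t
    unfolding H_def heston_barrier_def l_def using that
    by (auto intro!: derivative_eq_intros simp: field_simps)
  have px: "(p has_real_derivative \<gamma> * (1 / sqrt (1 + x\<^sup>2) ^ 3)) (at x)" for x
    unfolding p_def by (rule DERIV_cmult) (rule sqrt_one_plus_square_has_derivative)
  have ly: "((\<lambda>y. l y t) has_real_derivative b / y\<^sup>2) (at y)" if "0 < y" for y t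
    unfolding l_def using that
    by (auto intro!: derivative_eq_intros simp: field_simps power2_eq_square)
  have Hxx: "((\<lambda>x. H x y t * p x) has_real_derivative
      H x y t * ((p x)\<^sup>2 + \<gamma> * (1 / sqrt (1 + x\<^sup>2) ^ 3))) (at x)" for x y t
    using DERIV_mult[OF Hx px] by (rule DERIV_cong) (simp add: algebra_simps power2_eq_square)
  have Hxy: "((\<lambda>y. H x y t * p x) has_real_derivative H x y t * (p x * l y t)) (at y)" if "0 < y" for x y t
    using DERIV_cmult_right[OF Hy[OF that]] by (rule DERIV_cong) (simp add: algebra_simps)
  have Hyy: "((\<lambda>y. H x y t * l y t) has_real_derivative H x y t * ((l y t)\<^sup>2 + b / y\<^sup>2)) (at y)"
    if "0 < y" for x y t
    using DERIV_mult[OF Hy[OF that] ly[OF that]]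
    by (rule DERIV_cong) (simp add: algebra_simps power2_eq_square)
  have nz: "sqrt (1 + x\<^sup>2) \<noteq> 0" for x :: real
    using sum_power2_eq_zero_iff[of 1 x] by simp
  have cont: "continuous_on \<H> (\<lambda>z. H (fst z) (snd z) t)" "continuous_on \<H> (\<lambda>z. p (fst z))"
    "continuous_on \<H> (\<lambda>z. l (snd z) t)" for t
    unfolding H_def heston_barrier_def p_def l_def
    by (auto intro!: continuous_intros simp: half_plane_def nz simp del: real_sqrt_eq_zero_cancel_iff)
  have inv: "continuous_on \<H> (\<lambda>z. 1 / sqrt (1 + (fst z)\<^sup>2) ^ 3)"
    by (intro continuous_intros ballI power_not_zero nz)
  have b2: "continuous_on \<H> (\<lambda>z. b / (snd z)\<^sup>2)"
    by (intro continuous_intros ballI) (auto simp: half_plane_def)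
  show ?thesis
    unfolding C21_jet_def split_def
    by (intro ballI conjI allI impI Ht Hx Hy Hxx Hxy Hyy continuous_on_mult continuous_on_add
        continuous_on_power continuous_on_const cont inv b2)
qed

lemma cont_on_barrier: "cont_on (\<H> \<times> I) (heston_barrier b \<gamma> m M \<nu> a)"
  unfolding cont_on_def heston_barrier_def split_def
  by (auto intro!: continuous_intros simp: half_plane_def)

text \<open>The Feller condition leaves room for some \<open>b > 0\<close> with \<open>b + 1 < 2 \<kappa> \<theta> / \<sigma>\<^sup>2\<close>, which makes
  the coefficient of \<open>1/y\<close> positive.\<close>

lemma barrier_strict_supersolution:
  assumes \<sigma>: "0 < \<sigma>" and \<kappa>: "0 < \<kappa>" and \<theta>: "0 < \<theta>" and \<rho>: "\<bar>\<rho>\<bar> \<le> 1"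
    and b: "0 < b" "b + 1 < 2 * \<kappa> * \<theta> / \<sigma>\<^sup>2" and \<gamma>: "0 \<le> \<gamma>" and y: "0 < y"
    and p: "\<bar>p\<bar> \<le> \<gamma>" and s: "s \<le> \<gamma>" and \<mu>: "0 \<le> \<mu>" "\<mu> \<le> m"
    and M: "\<sigma> / 2 * (\<gamma>\<^sup>2 + \<gamma> + 2 * \<gamma> * m + m\<^sup>2) + \<sigma> / 2 * \<gamma> < M"
    and \<nu>: "\<sigma> * (\<gamma> * b) + \<bar>q\<bar> * \<gamma> + \<kappa> * \<theta> / \<sigma> * m + \<kappa> * b < \<nu>"
  shows "0 < (M * y + \<nu>) + heston_form \<sigma> \<rho> q \<kappa> \<theta> y p (\<mu> - b / y) (p\<^sup>2 + s) (p * (\<mu> - b / y))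
    ((\<mu> - b / y)\<^sup>2 + b / y\<^sup>2)"
proof -
  \<comment> \<open>After division by the barrier, the expression is a combination of y, 1 and 1/y.
    The spatial operator contributes \<open>- A\<close>, \<open>B\<close> and \<open>F\<close> to
    the three coefficients, and the time derivative contributes \<open>M\<close> and
    \<open>\<nu>\<close> to the first two; these are assumed large enough to make both
    positive.\<close>
  define A where "A = \<sigma> / 2 * (p\<^sup>2 + s + 2 * \<rho> * p * \<mu> + \<mu>\<^sup>2) - \<sigma> / 2 * p - \<kappa> * \<mu>"
  define B where "B = \<sigma> * (\<rho> * p * b) + \<sigma> * \<mu> * b + q * p - \<kappa> * \<theta> / \<sigma> * \<mu> - \<kappa> * b"
  define F where "F = b * \<sigma> / 2 * (2 * \<kappa> * \<theta> / \<sigma>\<^sup>2 - 1 - b)"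
  have id: "(M * y + \<nu>) + heston_form \<sigma> \<rho> q \<kappa> \<theta> y p (\<mu> - b / y) (p\<^sup>2 + s) (p * (\<mu> - b / y))
    ((\<mu> - b / y)\<^sup>2 + b / y\<^sup>2) = (M - A) * y + (\<nu> + B) + F / y"
    unfolding heston_form_def A_def B_def F_def using y \<sigma>
    by (simp add: field_simps power2_eq_square)
  have "\<bar>\<rho> * p\<bar> \<le> 1 * \<gamma>" unfolding abs_mult by (rule mult_mono) (use \<rho> p in auto)
  then have rp: "\<bar>\<rho> * p\<bar> \<le> \<gamma>" by simp
  have "p\<^sup>2 \<le> \<gamma>\<^sup>2" using p \<gamma> by (simp add: abs_le_square_iff[symmetric])
  moreover have "\<mu>\<^sup>2 \<le> m\<^sup>2" using \<mu> by (intro power_mono) auto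
  moreover have "\<rho> * p * \<mu> \<le> \<gamma> * m" using rp \<mu> \<gamma> by (intro mult_mono) auto
  ultimately have "\<sigma> / 2 * (p\<^sup>2 + s + 2 * \<rho> * p * \<mu> + \<mu>\<^sup>2) \<le> \<sigma> / 2 * (\<gamma>\<^sup>2 + \<gamma> + 2 * \<gamma> * m + m\<^sup>2)"
    using \<sigma> s by (intro mult_left_mono) auto
  moreover have "\<sigma> / 2 * (- p) \<le> \<sigma> / 2 * \<gamma>" using \<sigma> p by (intro mult_left_mono) auto
  moreover have "0 \<le> \<kappa> * \<mu>" using \<kappa> \<mu> by simp
  ultimately have "A < M" using M unfolding A_def by simp
  then have 1: "0 < (M - A) * y" using y by simp
  have "- (\<rho> * p) * b \<le> \<gamma> * b" using rp b by (intro mult_right_mono) auto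
  then have "\<sigma> * (- (\<rho> * p) * b) \<le> \<sigma> * (\<gamma> * b)" using \<sigma> by (intro mult_left_mono) auto
  moreover have "\<bar>q * p\<bar> \<le> \<bar>q\<bar> * \<gamma>" unfolding abs_mult using p by (intro mult_left_mono) auto
  moreover have "\<kappa> * \<theta> / \<sigma> * \<mu> \<le> \<kappa> * \<theta> / \<sigma> * m" using \<mu> \<kappa> \<theta> \<sigma> by (intro mult_left_mono) auto
  moreover have "0 \<le> \<sigma> * \<mu> * b" using \<sigma> \<mu> b by simp
  ultimately have 2: "0 < \<nu> + B" using \<nu> unfolding B_def by simp
  have "0 < F" unfolding F_def using b \<sigma> by (intro mult_pos_pos) auto
  then have "0 < F / y" using y by simp
  with 1 2 id show ?thesis by simp
qed

text \<open>For t at least \<open>a\<close>, the quotient of the barrier by the majorizer is at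
  least the exponential of \<open>- \<delta> * ln y + sqrt (1 + x\<^sup>2) + y\<close>, which is
  large near y = 0 and at infinity.\<close>

lemma barrier_dominates_majorizer:
  assumes b: "\<beta>\<^sub>0 - 1 + \<delta> = b" "0 < \<delta>" "\<delta> \<le> 1 / 2" and \<nu>: "0 \<le> \<nu>" "0 \<le> M" and \<epsilon>: "0 < \<epsilon>" and C: "0 < C"
  shows "\<exists>r R. 0 < r \<and> (\<forall>x y t. 0 < y \<longrightarrow> a \<le> t \<longrightarrow> R \<le> \<bar>x\<bar> \<or> y \<le> r \<or> R \<le> y \<longrightarrow>
    C * majorizer \<beta>\<^sub>0 \<gamma>\<^sub>0 \<mu>\<^sub>0 x y \<le> \<epsilon> * heston_barrier b (\<gamma>\<^sub>0 + 1) (\<mu>\<^sub>0 + 1) M \<nu> a x y t)"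
proof -
  \<comment> \<open>The logarithm of the factor to be gained, cut off at 0 so that the thresholds
    built from it are monotone in \<open>L\<close> and nonnegative.\<close>
  define L where "L = max 0 (ln (C / \<epsilon>))"
  have "C / \<epsilon> = exp (ln (C / \<epsilon>))" using C \<epsilon> by simp
  also have "\<dots> \<le> exp L" by (simp add: L_def)
  finally have CL: "C \<le> \<epsilon> * exp L" using \<epsilon> by (simp add: field_simps)
  have "C * majorizer \<beta>\<^sub>0 \<gamma>\<^sub>0 \<mu>\<^sub>0 x y \<le> \<epsilon> * heston_barrier b (\<gamma>\<^sub>0 + 1) (\<mu>\<^sub>0 + 1) M \<nu> a x y t"
    if y: "0 < y" and t: "a \<le> t" and out: "2 * L \<le> \<bar>x\<bar> \<or> y \<le> exp (- L / \<delta>) \<or> 2 * L \<le> y" for x y t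
  proof -
    have L0: "0 \<le> L" by (simp add: L_def)
    have x: "\<bar>x\<bar> \<le> sqrt (1 + x\<^sup>2)" by (rule real_le_rsqrt) simp
    \<comment> \<open>For large y the logarithm consumes at most half of the surplus y, thanks to
      \<open>\<delta> \<le> 1 / 2\<close>; this accounts for the threshold
      \<open>2 * L\<close>.\<close>
    have ly: "\<delta> * ln y \<le> y / 2"
    proof (cases "1 \<le> y")
      case True
      then have "\<delta> * ln y \<le> 1 / 2 * (y - 1)"
        using b y by (intro mult_mono ln_le_minus_one) auto
      then show ?thesis by simp
    next
      case False
      then have "\<delta> * ln y \<le> 0" using b y by (intro mult_nonneg_nonpos) auto
      then show ?thesis using y by simp
    qed
    have "L \<le> - \<delta> * ln y + sqrt (1 + x\<^sup>2) + y"
    proof -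
      have "L \<le> - \<delta> * ln y" if "y \<le> exp (- L / \<delta>)"
      proof -
        have "ln y \<le> - L / \<delta>" using that y by (metis ln_exp ln_le_cancel_iff exp_gt_zero)
        then show ?thesis using b by (simp add: field_simps)
      qed
      then show ?thesis using out ly x y L0 by auto
    qed
    moreover have "0 \<le> M * (t - a) * y" "0 \<le> \<nu> * (t - a)" using \<nu> t y by auto
    ultimately have "L + (- (\<beta>\<^sub>0 - 1) * ln y + (\<gamma>\<^sub>0 * sqrt (1 + x\<^sup>2) + \<mu>\<^sub>0 * y))
      \<le> - b * ln y + (\<gamma>\<^sub>0 + 1) * sqrt (1 + x\<^sup>2) + (\<mu>\<^sub>0 + 1 + M * (t - a)) * y + \<nu> * (t - a)"
      unfolding b(1)[symmetric] by (simp add: algebra_simps)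
    moreover have "majorizer \<beta>\<^sub>0 \<gamma>\<^sub>0 \<mu>\<^sub>0 x y = exp (- (\<beta>\<^sub>0 - 1) * ln y + (\<gamma>\<^sub>0 * sqrt (1 + x\<^sup>2) + \<mu>\<^sub>0 * y))"
      unfolding majorizer_def powr_def exp_add using y by simp
    ultimately have "exp L * majorizer \<beta>\<^sub>0 \<gamma>\<^sub>0 \<mu>\<^sub>0 x y \<le> heston_barrier b (\<gamma>\<^sub>0 + 1) (\<mu>\<^sub>0 + 1) M \<nu> a x y t"
      unfolding heston_barrier_def by (simp add: exp_add[symmetric])
    then have "\<epsilon> * (exp L * majorizer \<beta>\<^sub>0 \<gamma>\<^sub>0 \<mu>\<^sub>0 x y) \<le> \<epsilon> * heston_barrier b (\<gamma>\<^sub>0 + 1) (\<mu>\<^sub>0 + 1) M \<nu> a x y t"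
      using \<epsilon> by (intro mult_left_mono) auto
    moreover have "C * majorizer \<beta>\<^sub>0 \<gamma>\<^sub>0 \<mu>\<^sub>0 x y \<le> \<epsilon> * exp L * majorizer \<beta>\<^sub>0 \<gamma>\<^sub>0 \<mu>\<^sub>0 x y"
      using CL by (intro mult_right_mono) (auto simp: majorizer_def)
    ultimately show ?thesis by simp
  qed
  then show ?thesis by (intro exI[of _ "exp (- L / \<delta>)"] exI[of _ "2 * L"]) auto
qed

section \<open>Comparison for subsolutions of controlled growth\<close>

lemma cont_on_lincomb:
  assumes "cont_on Q v" "cont_on Q w"
  shows "cont_on Q (\<lambda>x y t. a * v x y t + b * w x y t)"
  using assms unfolding cont_on_def split_def by (intro continuous_intros)

lemma cont_on_subset: "cont_on Q v \<Longrightarrow> P \<subseteq> Q \<Longrightarrow> cont_on P v"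
  unfolding cont_on_def by (rule continuous_on_subset)

text \<open>\<open>\<tau>\<close> is quantified before \<open>a\<close> so that the step can be
  repeated from any later time. The witness \<open>1 / M\<close> depends only on the coefficients
  and the growth exponents.\<close>

lemma heston_phragmen_lindelof_step:
  fixes T :: ereal
  assumes \<sigma>: "0 < \<sigma>" and \<kappa>: "0 < \<kappa>" and \<theta>: "0 < \<theta>" and \<rho>: "\<bar>\<rho>\<bar> \<le> 1"
    and \<beta>: "1 \<le> \<beta>\<^sub>0" "\<beta>\<^sub>0 < 2 * \<kappa> * \<theta> / \<sigma>\<^sup>2" and \<gamma>: "0 \<le> \<gamma>\<^sub>0" and \<mu>: "0 \<le> \<mu>\<^sub>0" and C: "0 < C"
    and jet: "C21_jet (times_after_0 T) w wt wx wy wxx wxy wyy"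
    and cont: "cont_on (\<H> \<times> times_from_0 T) w"
    and sub: "\<And>x y t. 0 < y \<Longrightarrow> t \<in> times_after_0 T \<Longrightarrow>
      wt x y t + heston_form \<sigma> \<rho> q \<kappa> \<theta> y (wx x y t) (wy x y t) (wxx x y t) (wxy x y t) (wyy x y t) \<le> 0"
    and bound: "\<And>x y t. 0 < y \<Longrightarrow> t \<in> times_from_0 T \<Longrightarrow> w x y t \<le> C * majorizer \<beta>\<^sub>0 \<gamma>\<^sub>0 \<mu>\<^sub>0 x y"
  shows "\<exists>\<tau>>0. \<forall>a\<ge>0. (\<forall>x. \<forall>y>0. w x y a \<le> 0) \<longrightarrow>
    (\<forall>x y t. 0 < y \<longrightarrow> a \<le> t \<longrightarrow> t \<le> a + \<tau> \<longrightarrow> t \<in> times_from_0 T \<longrightarrow> w x y t \<le> 0)"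
proof -
  define D where "D = 2 * \<kappa> * \<theta> / \<sigma>\<^sup>2"
  \<comment> \<open>Half of the gap between \<open>\<beta>\<^sub>0\<close> and the Feller threshold
    keeps \<open>b + 1\<close> below the threshold; the cap 1/2 is the one required by
    \<open>barrier_dominates_majorizer\<close>.\<close>
  define \<delta> where "\<delta> = min (1/2) ((D - \<beta>\<^sub>0) / 2)"
  define b where "b = \<beta>\<^sub>0 - 1 + \<delta>"
  define \<gamma> where "\<gamma> = \<gamma>\<^sub>0 + 1"
  \<comment> \<open>The coefficient of y in the barrier starts at \<open>\<mu>\<^sub>0 + 1\<close>
    and grows by at most 1 during a time \<open>1 / M\<close>.\<close>
  define m where "m = \<mu>\<^sub>0 + 1 + 1"
  \<comment> \<open>\<open>M\<close> and \<open>\<nu>\<close> exceed by 1 the lower bounds demanded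
    in \<open>barrier_strict_supersolution\<close>.\<close>
  define M where "M = \<sigma> / 2 * (\<gamma>\<^sup>2 + \<gamma> + 2 * \<gamma> * m + m\<^sup>2) + \<sigma> / 2 * \<gamma> + 1"
  define \<nu> where "\<nu> = \<sigma> * (\<gamma> * b) + \<bar>q\<bar> * \<gamma> + \<kappa> * \<theta> / \<sigma> * m + \<kappa> * b + 1"
  have \<delta>: "0 < \<delta>" "\<delta> \<le> 1/2" using \<beta> by (auto simp: \<delta>_def D_def)
  have "\<delta> \<le> (D - \<beta>\<^sub>0) / 2" unfolding \<delta>_def by (rule min.cobounded2)
  moreover have "\<beta>\<^sub>0 < D" using \<beta> by (simp add: D_def)
  ultimately have "b + 1 < D" unfolding b_def by (simp add: field_simps)
  then have b: "0 < b" "b + 1 < 2 * \<kappa> * \<theta> / \<sigma>\<^sup>2"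
    using \<beta> \<delta> by (auto simp: b_def D_def)
  have \<gamma>0: "0 \<le> \<gamma>" and m0: "0 \<le> m" using \<gamma> \<mu> by (auto simp: \<gamma>_def m_def)
  have M0: "0 < M" unfolding M_def using \<sigma> \<gamma>0 m0 by (intro add_nonneg_pos add_nonneg_nonneg mult_nonneg_nonneg) auto
  have \<nu>0: "0 \<le> \<nu>" unfolding \<nu>_def using \<sigma> \<gamma>0 m0 b \<kappa> \<theta> by simp
  have "w x1 y1 t1 \<le> 0"
    if a: "0 \<le> a" and init: "\<forall>x. \<forall>y>0. w x y a \<le> 0" and y1: "0 < y1"
      and t1: "a \<le> t1" "t1 \<le> a + 1 / M" "t1 \<in> times_from_0 T" for a x1 y1 t1
  proof (rule ccontr)
    assume pos: "\<not> w x1 y1 t1 \<le> 0"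
    define H where "H = heston_barrier b \<gamma> (\<mu>\<^sub>0 + 1) M \<nu> a"
    have Hpos: "0 < H x y t" for x y t by (simp add: H_def heston_barrier_def)
    \<comment> \<open>This choice replaces the limit: at the supposed bad point the barrier term
      takes away exactly half of the positive value of \<open>w\<close>, so the difference is still
      positive there.\<close>
    define \<epsilon> where "\<epsilon> = w x1 y1 t1 / (2 * H x1 y1 t1)"
    have \<epsilon>: "0 < \<epsilon>" using pos Hpos by (simp add: \<epsilon>_def)
    have times: "{a<..t1} \<subseteq> times_after_0 T" "{a..t1} \<subseteq> times_from_0 T"
      using a t1 by (auto simp: times_after_0_def times_from_0_def intro: le_less_trans[of _ "ereal t1"])
    define p where "p = (\<lambda>x. \<gamma> * (x / sqrt (1 + x\<^sup>2)))"
    define s where "s = (\<lambda>x::real. \<gamma> * (1 / sqrt (1 + x\<^sup>2) ^ 3))"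
    define l where "l = (\<lambda>y t. \<mu>\<^sub>0 + 1 + M * (t - a) - b / y)"
    have H_jet: "C21_jet UNIV H (\<lambda>x y t. H x y t * (M * y + \<nu>))
      (\<lambda>x y t. H x y t * p x) (\<lambda>x y t. H x y t * l y t) (\<lambda>x y t. H x y t * ((p x)\<^sup>2 + s x))
      (\<lambda>x y t. H x y t * (p x * l y t)) (\<lambda>x y t. H x y t * ((l y t)\<^sup>2 + b / y\<^sup>2))"
      unfolding H_def p_def s_def l_def by (rule C21_jet_barrier)
    have H_super: "0 < (M * y + \<nu>) + heston_form \<sigma> \<rho> q \<kappa> \<theta> y (p x) (l y t) ((p x)\<^sup>2 + s x) (p x * l y t)
        ((l y t)\<^sup>2 + b / y\<^sup>2)" if "0 < y" "a < t" "t \<le> t1" for x y t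
      unfolding l_def
    proof (rule barrier_strict_supersolution[where \<gamma> = \<gamma> and m = m])
      have x: "\<bar>x\<bar> \<le> sqrt (1 + x\<^sup>2)" "1 \<le> sqrt (1 + x\<^sup>2)" by (rule real_le_rsqrt, simp)+
      then have "\<bar>x / sqrt (1 + x\<^sup>2)\<bar> \<le> 1" by (simp add: abs_divide pos_divide_le_eq add_pos_nonneg)
      then have "\<gamma> * \<bar>x / sqrt (1 + x\<^sup>2)\<bar> \<le> \<gamma> * 1" using \<gamma>0 by (rule mult_left_mono)
      then show "\<bar>p x\<bar> \<le> \<gamma>" unfolding p_def abs_mult using \<gamma>0 by simp
      have "1 \<le> sqrt (1 + x\<^sup>2) ^ 3" using x(2) by (rule one_le_power)
      then have "1 / sqrt (1 + x\<^sup>2) ^ 3 \<le> 1" unfolding divide_le_eq_1 by linarith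
      then have "\<gamma> * (1 / sqrt (1 + x\<^sup>2) ^ 3) \<le> \<gamma> * 1" using \<gamma>0 by (rule mult_left_mono)
      then show "s x \<le> \<gamma>" by (simp add: s_def)
      have "M * (t - a) \<le> M * (1 / M)" using that t1 M0 by (intro mult_left_mono) auto
      then show "\<mu>\<^sub>0 + 1 + M * (t - a) \<le> m" using M0 by (simp add: m_def)
      show "0 \<le> \<mu>\<^sub>0 + 1 + M * (t - a)" using M0 \<mu> that by simp
    qed (use \<sigma> \<kappa> \<theta> \<rho> b \<gamma>0 that in \<open>auto simp: M_def \<nu>_def\<close>)
    obtain r R where r: "0 < r" and far: "\<And>x y t. 0 < y \<Longrightarrow> a \<le> t \<Longrightarrow> R \<le> \<bar>x\<bar> \<or> y \<le> r \<or> R \<le> y \<Longrightarrow>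
        C * majorizer \<beta>\<^sub>0 \<gamma>\<^sub>0 \<mu>\<^sub>0 x y \<le> \<epsilon> * H x y t"
      using barrier_dominates_majorizer[OF b_def[symmetric] \<delta> \<nu>0 less_imp_le[OF M0] \<epsilon> C]
      unfolding H_def \<gamma>_def by blast
    \<comment> \<open>The factors \<open>1\<close> and \<open>- \<epsilon>\<close> are kept explicit
      to match the shape of the lemmas on linear combinations.\<close>
    have "1 * w x1 y1 t1 + (- \<epsilon>) * H x1 y1 t1 \<le> 0"
    proof (rule heston_maximum_principle[where v = "\<lambda>x y t. 1 * w x y t + (- \<epsilon>) * H x y t"])
      show "C21_jet {a<..t1} (\<lambda>x y t. 1 * w x y t + (- \<epsilon>) * H x y t)
        (\<lambda>x y t. 1 * wt x y t + (- \<epsilon>) * (H x y t * (M * y + \<nu>)))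
        (\<lambda>x y t. 1 * wx x y t + (- \<epsilon>) * (H x y t * p x))
        (\<lambda>x y t. 1 * wy x y t + (- \<epsilon>) * (H x y t * l y t))
        (\<lambda>x y t. 1 * wxx x y t + (- \<epsilon>) * (H x y t * ((p x)\<^sup>2 + s x)))
        (\<lambda>x y t. 1 * wxy x y t + (- \<epsilon>) * (H x y t * (p x * l y t)))
        (\<lambda>x y t. 1 * wyy x y t + (- \<epsilon>) * (H x y t * ((l y t)\<^sup>2 + b / y\<^sup>2)))"
        by (intro C21_jet_lincomb C21_jet_mono[OF jet times(1)] C21_jet_mono[OF H_jet subset_UNIV])
      show "cont_on (\<H> \<times> {a..t1}) (\<lambda>x y t. 1 * w x y t + (- \<epsilon>) * H x y t)"
        unfolding H_def using times(2)
        by (intro cont_on_lincomb cont_on_barrier cont_on_subset[OF cont]) auto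
      fix x y t :: real assume y: "0 < y" and t: "a < t" "t \<le> t1"
      let ?E = "(M * y + \<nu>) + heston_form \<sigma> \<rho> q \<kappa> \<theta> y (p x) (l y t) ((p x)\<^sup>2 + s x) (p x * l y t)
        ((l y t)\<^sup>2 + b / y\<^sup>2)"
      \<comment> \<open>Homogeneity, obtained from \<open>heston_form_lincomb\<close> with second
        coefficient 0.\<close>
      have "heston_form \<sigma> \<rho> q \<kappa> \<theta> y (H x y t * p x) (H x y t * l y t) (H x y t * ((p x)\<^sup>2 + s x))
          (H x y t * (p x * l y t)) (H x y t * ((l y t)\<^sup>2 + b / y\<^sup>2)) =
        H x y t * heston_form \<sigma> \<rho> q \<kappa> \<theta> y (p x) (l y t) ((p x)\<^sup>2 + s x) (p x * l y t) ((l y t)\<^sup>2 + b / y\<^sup>2)"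
        using heston_form_lincomb[of \<sigma> \<rho> q \<kappa> \<theta> y "H x y t" "p x" 0 0] by simp
      moreover have "wt x y t + heston_form \<sigma> \<rho> q \<kappa> \<theta> y (wx x y t) (wy x y t) (wxx x y t) (wxy x y t) (wyy x y t) \<le> 0"
        using y t times by (intro sub) auto
      moreover have "0 < \<epsilon> * (H x y t * ?E)"
        using \<epsilon> Hpos H_super[OF y t] by (intro mult_pos_pos)
      ultimately show "1 * wt x y t + (- \<epsilon>) * (H x y t * (M * y + \<nu>)) +
        heston_form \<sigma> \<rho> q \<kappa> \<theta> y (1 * wx x y t + (- \<epsilon>) * (H x y t * p x))
          (1 * wy x y t + (- \<epsilon>) * (H x y t * l y t))
          (1 * wxx x y t + (- \<epsilon>) * (H x y t * ((p x)\<^sup>2 + s x)))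
          (1 * wxy x y t + (- \<epsilon>) * (H x y t * (p x * l y t)))
          (1 * wyy x y t + (- \<epsilon>) * (H x y t * ((l y t)\<^sup>2 + b / y\<^sup>2))) < 0"
        unfolding heston_form_lincomb by (simp add: algebra_simps)
    next
      fix x y :: real assume "0 < y"
      moreover have "0 < \<epsilon> * H x y a" using \<epsilon> Hpos by simp
      moreover have "w x y a \<le> 0" using init \<open>0 < y\<close> by blast
      ultimately show "1 * w x y a + (- \<epsilon>) * H x y a \<le> 0" by simp
    next
      fix x y t :: real assume *: "0 < y" "a \<le> t" "t \<le> t1" "R \<le> \<bar>x\<bar> \<or> y \<le> r \<or> R \<le> y"
      then have "w x y t \<le> C * majorizer \<beta>\<^sub>0 \<gamma>\<^sub>0 \<mu>\<^sub>0 x y" using times by (intro bound) auto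
      with far[OF *(1,2,4)] show "1 * w x y t + (- \<epsilon>) * H x y t \<le> 0" by simp
    qed (use \<sigma> \<rho> r y1 t1 in auto)
    moreover have "\<epsilon> * H x1 y1 t1 = w x1 y1 t1 / 2"
      using Hpos[of x1 y1 t1] by (simp add: \<epsilon>_def)
    ultimately show False using pos by simp
  qed
  then show ?thesis using M0 by (intro exI[of _ "1 / M"]) auto
qed

text \<open>Induction on n covers the times up to \<open>n * \<tau>\<close>, each stage restarting
  from the nonpositive values reached at the end of the previous one; the Archimedean property then
  reaches every \<open>t\<close>.\<close>

lemma heston_phragmen_lindelof:
  fixes T :: ereal
  assumes \<sigma>: "0 < \<sigma>" and \<kappa>: "0 < \<kappa>" and \<theta>: "0 < \<theta>" and \<rho>: "\<bar>\<rho>\<bar> \<le> 1"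
    and \<beta>: "1 \<le> \<beta>\<^sub>0" "\<beta>\<^sub>0 < 2 * \<kappa> * \<theta> / \<sigma>\<^sup>2" and \<gamma>: "0 \<le> \<gamma>\<^sub>0" and \<mu>: "0 \<le> \<mu>\<^sub>0" and C: "0 < C"
    and jet: "C21_jet (times_after_0 T) w wt wx wy wxx wxy wyy"
    and cont: "cont_on (\<H> \<times> times_from_0 T) w"
    and sub: "\<And>x y t. 0 < y \<Longrightarrow> t \<in> times_after_0 T \<Longrightarrow>
      wt x y t + heston_form \<sigma> \<rho> q \<kappa> \<theta> y (wx x y t) (wy x y t) (wxx x y t) (wxy x y t) (wyy x y t) \<le> 0"
    and bound: "\<And>x y t. 0 < y \<Longrightarrow> t \<in> times_from_0 T \<Longrightarrow> w x y t \<le> C * majorizer \<beta>\<^sub>0 \<gamma>\<^sub>0 \<mu>\<^sub>0 x y"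
    and init: "\<And>x y. 0 < y \<Longrightarrow> w x y 0 \<le> 0"
    and y: "0 < y" and t: "t \<in> times_from_0 T"
  shows "w x y t \<le> 0"
proof -
  have "\<exists>\<tau>>0. \<forall>a\<ge>0. (\<forall>x. \<forall>y>0. w x y a \<le> 0) \<longrightarrow>
    (\<forall>x y t. 0 < y \<longrightarrow> a \<le> t \<longrightarrow> t \<le> a + \<tau> \<longrightarrow> t \<in> times_from_0 T \<longrightarrow> w x y t \<le> 0)"
    by (rule heston_phragmen_lindelof_step[OF \<sigma> \<kappa> \<theta> \<rho> \<beta> \<gamma> \<mu> C jet cont]) (fact sub bound)+
  then obtain \<tau> where \<tau>: "0 < \<tau>" "\<And>a x y t. 0 \<le> a \<Longrightarrow> \<forall>x. \<forall>y>0. w x y a \<le> 0 \<Longrightarrow>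
    0 < y \<Longrightarrow> a \<le> t \<Longrightarrow> t \<le> a + \<tau> \<Longrightarrow> t \<in> times_from_0 T \<Longrightarrow> w x y t \<le> 0"
    by metis
  have "w x y t \<le> 0" if "0 < y" "t \<in> times_from_0 T" "t \<le> real n * \<tau>" for n x y t
    using that
  proof (induction n arbitrary: x y t)
    case 0
    then have "t = 0" by (auto simp: times_from_0_def)
    with init 0 show ?case by simp
  next
    case (Suc n)
    show ?case
    proof (cases "t \<le> real n * \<tau>")
      case False
      \<comment> \<open>The restart time precedes \<open>t\<close>, hence lies before
        \<open>T\<close>, and the induction hypothesis applies to it.\<close>
      have "real n * \<tau> \<in> times_from_0 T"
        using False Suc.prems \<tau>(1) by (auto simp: times_from_0_def intro: le_less_trans[of _ "ereal t"])
      then have "\<forall>x. \<forall>y>0. w x y (real n * \<tau>) \<le> 0" using Suc.IH by simp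
      then show ?thesis
        by (rule \<tau>(2)[rotated]) (use False Suc.prems \<tau>(1) in \<open>auto simp: algebra_simps\<close>)
    qed (use Suc in auto)
  qed
  moreover obtain n where "t \<le> real n * \<tau>"
    using reals_Archimedean3[OF \<tau>(1)] less_imp_le by metis
  ultimately show ?thesis using y t by blast
qed

section \<open>The solution and the exponential majorant\<close>

lemma cont_on_slice:
  "cont_on (\<H> \<times> I) F \<Longrightarrow> t \<in> I \<Longrightarrow> continuous_on \<H> (\<lambda>(x, y). F x y t)"
  unfolding cont_on_def split_def
  by (rule continuous_on_compose2[where f = "\<lambda>p. (p, t)" and g = "\<lambda>z. F (fst (fst z)) (snd (fst z)) (snd z)", simplified])
    (auto intro!: continuous_intros)

text \<open>The existence clauses of \<open>C21\<close> turn each \<open>deriv\<close> into a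
  genuine derivative, and joint continuity is restricted to fixed times.\<close>

lemma C21_jet_of_C21:
  assumes "C21 T u"
  shows "C21_jet (times_after_0 T) u (Dt u)
    (\<lambda>x \<xi> t. Dx (\<lambda>x \<xi>. u x \<xi> t) x \<xi>) (\<lambda>x \<xi> t. Dxi (\<lambda>x \<xi>. u x \<xi> t) x \<xi>)
    (\<lambda>x \<xi> t. Dx (Dx (\<lambda>x \<xi>. u x \<xi> t)) x \<xi>) (\<lambda>x \<xi> t. Dxi (Dx (\<lambda>x \<xi>. u x \<xi> t)) x \<xi>)
    (\<lambda>x \<xi> t. Dxi (Dxi (\<lambda>x \<xi>. u x \<xi> t)) x \<xi>)"
proof -
  have D: "(\<lambda>s. u x \<xi> s) field_differentiable (at t) \<and>
       (\<lambda>y. u y \<xi> t) field_differentiable (at x) \<and>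
       (\<lambda>\<eta>. u x \<eta> t) field_differentiable (at \<xi>) \<and>
       (\<lambda>y. Dx (\<lambda>x \<xi>. u x \<xi> t) y \<xi>) field_differentiable (at x) \<and>
       (\<lambda>\<eta>. Dx (\<lambda>x \<xi>. u x \<xi> t) x \<eta>) field_differentiable (at \<xi>) \<and>
       (\<lambda>\<eta>. Dxi (\<lambda>x \<xi>. u x \<xi> t) x \<eta>) field_differentiable (at \<xi>)"
    if "0 < \<xi>" "t \<in> times_after_0 T" for x \<xi> t
    using assms that unfolding C21_def half_plane_def by auto
  have slices: "continuous_on \<H> (\<lambda>(x, \<xi>). Dx (Dx (\<lambda>x \<xi>. u x \<xi> t)) x \<xi>) \<and>
      continuous_on \<H> (\<lambda>(x, \<xi>). Dxi (Dx (\<lambda>x \<xi>. u x \<xi> t)) x \<xi>) \<and>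
      continuous_on \<H> (\<lambda>(x, \<xi>). Dxi (Dxi (\<lambda>x \<xi>. u x \<xi> t)) x \<xi>)"
    if "t \<in> times_after_0 T" for t
    using assms that unfolding C21_def Let_def
    by (intro conjI cont_on_slice[of "times_after_0 T" "\<lambda>x \<xi> t. Dx (Dx (\<lambda>x \<xi>. u x \<xi> t)) x \<xi>"]
      cont_on_slice[of "times_after_0 T" "\<lambda>x \<xi> t. Dxi (Dx (\<lambda>x \<xi>. u x \<xi> t)) x \<xi>"]
      cont_on_slice[of "times_after_0 T" "\<lambda>x \<xi> t. Dxi (Dxi (\<lambda>x \<xi>. u x \<xi> t)) x \<xi>"]) blast+
  show ?thesis
    unfolding C21_jet_def
  proof (intro ballI conjI allI impI)
    fix t x and \<xi> :: real
    assume "t \<in> times_after_0 T" "0 < \<xi>"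
    note D = D[OF this(2,1), of x]
    show "((\<lambda>t. u x \<xi> t) has_real_derivative Dt u x \<xi> t) (at t)"
      "((\<lambda>x. u x \<xi> t) has_real_derivative Dx (\<lambda>x \<xi>. u x \<xi> t) x \<xi>) (at x)"
      "((\<lambda>y. u x y t) has_real_derivative Dxi (\<lambda>x \<xi>. u x \<xi> t) x \<xi>) (at \<xi>)"
      using D by (simp_all add: Dt_def Dx_def Dxi_def DERIV_deriv_iff_field_differentiable)
    \<comment> \<open>Only the outer derivative may be unfolded, hence the instantiated definitions
      here and below.\<close>
    show "((\<lambda>x. Dx (\<lambda>x \<xi>. u x \<xi> t) x \<xi>) has_real_derivative Dx (Dx (\<lambda>x \<xi>. u x \<xi> t)) x \<xi>) (at x)"
      using D unfolding Dx_def[of "Dx _"] by (simp add: DERIV_deriv_iff_field_differentiable)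
    show "((\<lambda>y. Dx (\<lambda>x \<xi>. u x \<xi> t) x y) has_real_derivative Dxi (Dx (\<lambda>x \<xi>. u x \<xi> t)) x \<xi>) (at \<xi>)"
      "((\<lambda>y. Dxi (\<lambda>x \<xi>. u x \<xi> t) x y) has_real_derivative Dxi (Dxi (\<lambda>x \<xi>. u x \<xi> t)) x \<xi>) (at \<xi>)"
      using D unfolding Dxi_def[of "Dx _"] Dxi_def[of "Dxi _"]
      by (simp_all add: DERIV_deriv_iff_field_differentiable)
  qed (use slices in blast)+
qed

lemma C21_jet_exponential:
  fixes r K\<^sub>0 K\<^sub>1 \<omega> :: real
  defines "E \<equiv> \<lambda>x y t. exp (r * t) * (K\<^sub>1 * exp (x + \<omega> * y))"
  shows "C21_jet I (\<lambda>x y t. exp (r * t) * (K\<^sub>1 * exp (x + \<omega> * y) + K\<^sub>0))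
    (\<lambda>x y t. r * (exp (r * t) * (K\<^sub>1 * exp (x + \<omega> * y) + K\<^sub>0)))
    E (\<lambda>x y t. \<omega> * E x y t) E (\<lambda>x y t. \<omega> * E x y t) (\<lambda>x y t. \<omega>\<^sup>2 * E x y t)"
proof -
  have Et: "((\<lambda>t. E x y t) has_real_derivative r * E x y t) (at t)" for x y t
    unfolding E_def by (auto intro!: derivative_eq_intros)
  have Ex: "((\<lambda>x. E x y t) has_real_derivative E x y t) (at x)" for x y t
    unfolding E_def by (auto intro!: derivative_eq_intros)
  have Ey: "((\<lambda>y. E x y t) has_real_derivative \<omega> * E x y t) (at y)" for x y t
    unfolding E_def by (auto intro!: derivative_eq_intros)
  have K: "((\<lambda>t. exp (r * t) * K\<^sub>0) has_real_derivative r * (exp (r * t) * K\<^sub>0)) (at t)" for t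
    by (auto intro!: derivative_eq_intros)
  have cont: "continuous_on \<H> (\<lambda>z. E (fst z) (snd z) t)" for t
    unfolding E_def by (intro continuous_intros)
  have eq: "exp (r * t) * (K\<^sub>1 * exp (x + \<omega> * y) + K\<^sub>0) = E x y t + exp (r * t) * K\<^sub>0" for x y t
    by (simp add: E_def distrib_left)
  have UD: "((\<lambda>t. E x y t + exp (r * t) * K\<^sub>0) has_real_derivative r * (E x y t + exp (r * t) * K\<^sub>0)) (at t)"
    "((\<lambda>x. E x y t + exp (r * t) * K\<^sub>0) has_real_derivative E x y t) (at x)"
    "((\<lambda>y. E x y t + exp (r * t) * K\<^sub>0) has_real_derivative \<omega> * E x y t) (at y)" for x y t
    using DERIV_add[OF Et K] DERIV_add[OF Ex DERIV_const] DERIV_add[OF Ey DERIV_const]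
    by (simp_all add: distrib_left)
  have Eyy: "((\<lambda>y. \<omega> * E x y t) has_real_derivative \<omega>\<^sup>2 * E x y t) (at y)" for x y t
    using DERIV_cmult[OF Ey, of \<omega>] by (simp add: power2_eq_square mult.assoc)
  show ?thesis
    unfolding C21_jet_def split_def eq
    by (intro ballI conjI allI impI UD Ex Ey Eyy continuous_on_mult continuous_on_const cont)
qed

text \<open>Since x has coefficient 1 in the exponent, the diffusion and drift terms in
  \<open>\<sigma> * y / 2\<close> cancel. What remains is \<open>r * K\<close> plus \<open>E\<close>
  times a constant and a multiple of y, made nonnegative by the first and the second bound on
  \<open>\<omega>\<close> respectively.\<close>

lemma exponential_supersolution:
  fixes \<sigma> \<rho> q \<kappa> \<theta> r K E \<omega> :: real
  assumes \<sigma>: "0 < \<sigma>" and \<kappa>: "0 < \<kappa>" and \<theta>: "0 < \<theta>" and y: "0 < y" and "0 \<le> r" "0 \<le> K" "0 \<le> E" "0 \<le> \<omega>"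
    and \<omega>: "\<omega> \<le> min ((r + q) / (\<kappa> * (\<theta> / \<sigma>))) (2 * (\<kappa> - \<sigma> * \<rho>) / \<sigma>)"
  shows "0 \<le> r * (E + K) + heston_form \<sigma> \<rho> q \<kappa> \<theta> y E (\<omega> * E) E (\<omega> * E) (\<omega>\<^sup>2 * E)"
proof -
  have "0 < \<kappa> * (\<theta> / \<sigma>)" using \<sigma> \<kappa> \<theta> by simp
  moreover have "\<omega> \<le> (r + q) / (\<kappa> * (\<theta> / \<sigma>))" using \<omega> by simp
  ultimately have "\<omega> * (\<kappa> * (\<theta> / \<sigma>)) \<le> r + q" by (simp only: pos_le_divide_eq)
  then have 1: "0 \<le> r + q - \<kappa> * (\<theta> / \<sigma>) * \<omega>" by (simp add: mult.commute)
  have "\<omega> * \<sigma> \<le> 2 * (\<kappa> - \<sigma> * \<rho>)" using \<omega> \<sigma> by (simp add: pos_le_divide_eq)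
  then have 2: "0 \<le> \<omega> * y * (\<kappa> - \<sigma> * \<rho> - \<sigma> * \<omega> / 2)"
    using \<open>0 \<le> \<omega>\<close> y by (intro mult_nonneg_nonneg) (auto simp: mult.commute)
  have "r * (E + K) + heston_form \<sigma> \<rho> q \<kappa> \<theta> y E (\<omega> * E) E (\<omega> * E) (\<omega>\<^sup>2 * E)
    = r * K + E * ((r + q - \<kappa> * (\<theta> / \<sigma>) * \<omega>) + \<omega> * y * (\<kappa> - \<sigma> * \<rho> - \<sigma> * \<omega> / 2))"
    unfolding heston_form_def by (simp add: algebra_simps power2_eq_square)
  also have "0 \<le> \<dots>" using 1 2 assms by simp
  finally show ?thesis .
qed

theorem corollary4p5:
  fixes T :: ereal
    and \<rho> q\<^sub>r \<sigma> \<kappa> \<theta> r\<^sub>0 \<beta>\<^sub>0 \<gamma>\<^sub>0 \<mu>\<^sub>0 K\<^sub>0 K\<^sub>1 \<omega> C :: real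
    and u :: "real \<Rightarrow> real \<Rightarrow> real \<Rightarrow> real"
  assumes "0 < T"
    and "-1 < \<rho>" and "\<rho> < 1"
    and "0 < \<sigma>" and "0 < \<kappa>" and "0 < \<theta>"
    and "\<kappa> \<ge> \<sigma> * \<rho>"
    and "(1/2) * \<sigma>\<^sup>2 - \<kappa> * \<theta> < 0"
    and "0 \<le> r\<^sub>0" and "r\<^sub>0 + q\<^sub>r \<ge> 0"
    and "1 \<le> \<gamma>\<^sub>0"
    and "0 < \<beta>\<^sub>0" and "0 < \<mu>\<^sub>0"
    and "1 \<le> \<beta>\<^sub>0" and "\<beta>\<^sub>0 < 2 * \<kappa> * \<theta> / \<sigma>\<^sup>2"
    and "\<beta>\<^sub>0 - 1 < \<mu>\<^sub>0"
    and "heston_strong_solution \<sigma> \<rho> q\<^sub>r \<kappa> \<theta> T u"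
    and "0 < C"
    and "\<forall>(x, \<xi>)\<in>\<H>. \<forall>t\<in>times_from_0 T. \<bar>u x \<xi> t\<bar> \<le> C * majorizer \<beta>\<^sub>0 \<gamma>\<^sub>0 \<mu>\<^sub>0 x \<xi>"
    and "0 \<le> K\<^sub>0" and "0 \<le> K\<^sub>1"
    and "0 \<le> \<omega>" and "\<omega> < \<mu>\<^sub>0"
    and "\<omega> \<le> min ((r\<^sub>0 + q\<^sub>r) / (\<kappa> * (\<theta> / \<sigma>))) (2 * (\<kappa> - \<sigma> * \<rho>) / \<sigma>)"
    and "\<forall>(x, \<xi>)\<in>\<H>. \<bar>u x \<xi> 0\<bar> \<le> K\<^sub>1 * exp (x + \<omega> * \<xi>) + K\<^sub>0"
  shows "\<forall>(x, \<xi>)\<in>\<H>. \<forall>t\<in>times_from_0 T.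
           \<bar>u x \<xi> t\<bar> \<le> exp (r\<^sub>0 * t) * (K\<^sub>1 * exp (x + \<omega> * \<xi>) + K\<^sub>0)"
proof -
  let ?U = "\<lambda>x y t. exp (r\<^sub>0 * t) * (K\<^sub>1 * exp (x + \<omega> * y) + K\<^sub>0)"
  let ?E = "\<lambda>x y t. exp (r\<^sub>0 * t) * (K\<^sub>1 * exp (x + \<omega> * y))"
  have U: "0 \<le> ?U x y t" for x y t using \<open>0 \<le> K\<^sub>0\<close> \<open>0 \<le> K\<^sub>1\<close> by simp
  have sol: "C0 T u" "C21 T u"
    and eq: "\<And>x \<xi> t. 0 < \<xi> \<Longrightarrow> t \<in> times_after_0 T \<Longrightarrow>
      Dt u x \<xi> t + heston_op \<sigma> \<rho> q\<^sub>r \<kappa> \<theta> (\<lambda>x \<xi>. u x \<xi> t) x \<xi> = 0"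
    using \<open>heston_strong_solution \<sigma> \<rho> q\<^sub>r \<kappa> \<theta> T u\<close>
    unfolding heston_strong_solution_def half_plane_def by auto
  have bound: "\<bar>u x y t\<bar> \<le> C * majorizer \<beta>\<^sub>0 \<gamma>\<^sub>0 \<mu>\<^sub>0 x y" if "0 < y" "t \<in> times_from_0 T" for x y t
    using that assms(19) by (auto simp: half_plane_def)
  have init: "\<bar>u x y 0\<bar> \<le> K\<^sub>1 * exp (x + \<omega> * y) + K\<^sub>0" if "0 < y" for x y
    using that assms(25) by (auto simp: half_plane_def)
  \<comment> \<open>The equation is linear, so \<open>s\<close> equal to 1 or -1 treats both halves
    of the absolute value at once.\<close>
  have signed: "s * u x y t + (-1) * ?U x y t \<le> 0"
    if s: "\<bar>s\<bar> = 1" and y: "0 < y" and t: "t \<in> times_from_0 T" for s x y t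
  proof (rule heston_phragmen_lindelof[where w = "\<lambda>x y t. s * u x y t + (-1) * ?U x y t",
        OF \<open>0 < \<sigma>\<close> \<open>0 < \<kappa>\<close> \<open>0 < \<theta>\<close> _ \<open>1 \<le> \<beta>\<^sub>0\<close> \<open>\<beta>\<^sub>0 < 2 * \<kappa> * \<theta> / \<sigma>\<^sup>2\<close> _ _ \<open>0 < C\<close>
          C21_jet_lincomb[OF C21_jet_of_C21[OF sol(2)] C21_jet_exponential]])
    show "cont_on (\<H> \<times> times_from_0 T) (\<lambda>x y t. s * u x y t + (-1) * ?U x y t)"
      using sol(1) unfolding C0_def
      by (rule cont_on_lincomb) (auto simp: cont_on_def split_def intro!: continuous_intros)
    show "s * Dt u x y t + (-1) * (r\<^sub>0 * ?U x y t)
        + heston_form \<sigma> \<rho> q\<^sub>r \<kappa> \<theta> y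
          (s * Dx (\<lambda>x \<xi>. u x \<xi> t) x y + (-1) * ?E x y t)
          (s * Dxi (\<lambda>x \<xi>. u x \<xi> t) x y + (-1) * (\<omega> * ?E x y t))
          (s * Dx (Dx (\<lambda>x \<xi>. u x \<xi> t)) x y + (-1) * ?E x y t)
          (s * Dxi (Dx (\<lambda>x \<xi>. u x \<xi> t)) x y + (-1) * (\<omega> * ?E x y t))
          (s * Dxi (Dxi (\<lambda>x \<xi>. u x \<xi> t)) x y + (-1) * (\<omega>\<^sup>2 * ?E x y t)) \<le> 0"
      if y: "0 < y" and t: "t \<in> times_after_0 T" for x y t
    proof -
      \<comment> \<open>\<open>?U\<close> is split into \<open>?E\<close>, which carries all spatial
        derivatives, and its part that is constant in space.\<close>
      have "0 \<le> r\<^sub>0 * (?E x y t + exp (r\<^sub>0 * t) * K\<^sub>0) + heston_form \<sigma> \<rho> q\<^sub>r \<kappa> \<theta> y (?E x y t)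
          (\<omega> * ?E x y t) (?E x y t) (\<omega> * ?E x y t) (\<omega>\<^sup>2 * ?E x y t)"
        by (rule exponential_supersolution) (use assms y in simp_all)
      moreover have "s * (Dt u x y t + heston_op \<sigma> \<rho> q\<^sub>r \<kappa> \<theta> (\<lambda>x \<xi>. u x \<xi> t) x y) = 0"
        using eq[OF y t] by simp
      then have "s * Dt u x y t + s * heston_form \<sigma> \<rho> q\<^sub>r \<kappa> \<theta> y (Dx (\<lambda>x \<xi>. u x \<xi> t) x y)
          (Dxi (\<lambda>x \<xi>. u x \<xi> t) x y) (Dx (Dx (\<lambda>x \<xi>. u x \<xi> t)) x y)
          (Dxi (Dx (\<lambda>x \<xi>. u x \<xi> t)) x y) (Dxi (Dxi (\<lambda>x \<xi>. u x \<xi> t)) x y) = 0"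
        unfolding heston_op_def heston_form_def distrib_left .
      ultimately show ?thesis
        unfolding heston_form_lincomb by (simp add: distrib_left)
    qed
    show "s * u x y t + (-1) * ?U x y t \<le> C * majorizer \<beta>\<^sub>0 \<gamma>\<^sub>0 \<mu>\<^sub>0 x y"
      if "0 < y" "t \<in> times_from_0 T" for x y t
    proof -
      \<comment> \<open>Subtracting the nonnegative \<open>?U\<close> preserves the upper growth
        bound; no lower bound on the difference enters the comparison.\<close>
      have "s * u x y t \<le> \<bar>u x y t\<bar>" using s by (metis abs_ge_self abs_mult mult_1)
      then show ?thesis using bound[OF that, of x] U[of t x y] by linarith
    qed
    show "s * u x y 0 + (-1) * ?U x y 0 \<le> 0" if "0 < y" for x y
    proof -
      have "s * u x y 0 \<le> \<bar>u x y 0\<bar>" using s by (metis abs_ge_self abs_mult mult_1)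
      then show ?thesis using init[OF that, of x] by simp
    qed
  qed (use assms y t in auto)
  have "\<bar>u x y t\<bar> \<le> ?U x y t" if "0 < y" "t \<in> times_from_0 T" for x y t
    using signed[of 1, OF _ that, of x] signed[of "-1", OF _ that, of x] by (simp add: abs_le_iff)
  then show ?thesis by (auto simp: half_plane_def)
qed

end
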